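(* Suppose that the complexity of computing one component $\nabla_i f$ of the gradient of $f$ is $\mathcal{O}(s)$. Let $\varepsilon>0$, $0<\delta<1$, and $\overline{L}=\frac1n\sum_{i=1}^nL_i>0$. Then the algorithmic (arithmetic) complexity of the Accelerated Meta-algorithm with coordinate descent as the inner method and regularization parameter $H=\overline{L}$, run from $x_0$ so as to produce a point $v_{\widetilde{N}}$ with $$\Pr\left(f(v_{\widetilde{N}})-f(x_* )<\varepsilon\right)\geq1-\delta,$$ is $$T=\mathcal{O}\left(s\cdot n\cdot\sqrt{\frac{\overline{L}\,\|x_0-x_*\|_2^2}{\varepsilon}}\,\log\left\{\frac{1}{\varepsilon^{1/2}\delta}\right\}\right).$$
   Context: Standing assumptions: $f:\mathbb{R}^n\to\mathbb{R}$ is differentiable and convex, with a minimizer $x_*$; $\nabla f$ is $L$-Lipschitz continuous with respect to $\|\cdot\|_2$; for each $i\in\{1,\dots,n\}$ there is a constant $L_i$ such that $|\nabla_i f(x+ue_i)-\nabla_i f(x)|\leq L_i|u|$ for all $x\in\mathbb{R}^n$, $u\in\mathbb{R}$, where $e_i$ is the $i$-th unit basis vector. Accelerated Meta-algorithm (inputs $H>0$, $x_0\in\mathbb{R}^n$): set $\lambda=\frac{1}{2H}$, $A_0=0$, $v_0=x_0$. For $k=0,\dots,\widetilde{N}-1$: $a_{k+1}=\frac{\lambda+\sqrt{\lambda^2+4\lambda A_k}}{2}$; $A_{k+1}=A_k+a_{k+1}$; $\widetilde{x}_k=\frac{A_kv_k+a_{k+1}x_k}{A_{k+1}}$; let $v_{k+1}$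 be the approximate solution, returned by an inner method, of the auxiliary problem $\min_{y\in\mathbb{R}^n}F_k(y)$, $F_k(y)=f(y)+\frac{H}{2}\|y-\widetilde{x}_k\|_2^2$; set $x_{k+1}=x_k-a_{k+1}\nabla f(v_{k+1})$. Return $v_{\widetilde{N}}$. Inner method (coordinate descent applied to $F=F_k$, with $N_\delta$ iterations, started at $y_0=\widetilde{x}_k$, updates performed in place): with $Z=\sum_{i=1}^n(H+L_i)$ and $p_i=(H+L_i)/Z$, for $j=0,\dots,N_\delta-1$ draw (independently) an index $i$ with probability $p_i$ and set $y_{j+1}=y_j-\frac{1}{H+L_i}\nabla_iF(y_j)\,e_i$. Return $y_{N_\delta}$. The probability is over all random index choices. The iteration counts are $\widetilde{N}=\left\lceil\frac{4\sqrt{15}}{5}\sqrt{H\|x_0-x_*\|_2^2/\varepsilon}\,\right\rceil$ and $N_\delta=\left\lceil\frac{Z}{H}\ln\left\{\frac{\widetilde{N}}{\delta}\left(1+\frac{L}{H}\right)\left(3+\frac{2L}{H}\right)^2\right\}\right\rceil$. Complexity is the total number of elementary operations; computing the full gradient of $f$ costs $\mathcal{O}(s\cdot n)$. Convention: the $\mathcal{O}(\cdot)$ bound is for small $\varepsilon,\delta$ and disregards absolute constants and factors logarithmic in the problem parameters (such as $\log(L/H)$). *)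

theory Defs
  imports "HOL-Probability.Probability"
begin

definition grad :: "(real ^ 'n \<Rightarrow> real) \<Rightarrow> real ^ 'n \<Rightarrow> real ^ 'n" where
  "grad f x = (THE D. GDERIV f x :> D)"

definition mean_const :: "('n::finite \<Rightarrow> real) \<Rightarrow> real" where
  "mean_const Li = (\<Sum>i\<in>UNIV. Li i) / real CARD('n)"

definition total_const :: "real \<Rightarrow> ('n::finite \<Rightarrow> real) \<Rightarrow> real" where
  "total_const H Li = (\<Sum>i\<in>UNIV. H + Li i)"

definition prox_objective :: "(real ^ 'n \<Rightarrow> real) \<Rightarrow> real \<Rightarrow> real ^ 'n \<Rightarrow> real ^ 'n \<Rightarrow> real" where
  "prox_objective f H xt y = f y + H / 2 * (norm (y - xt))\<^sup>2"

text \<open>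
  Randomised procedures return the joint distribution of their result and of the number of
  elementary operations performed.  One elementary operation is one real \<open>+\<close>, \<open>-\<close>, \<open>*\<close>, \<open>/\<close> or
  square root, the copying of one coordinate, or one random draw of an index.  The evaluation of
  a derivative is charged according to cost functions passed as arguments: \<open>cc i y\<close> for the
  \<open>i\<close>-th partial derivative at \<open>y\<close>, and \<open>gc y\<close> for the full gradient at \<open>y\<close>.
\<close>

text \<open>For \<open>H > 0\<close> and \<open>Li \<ge> 0\<close> the weights are nonnegative and sum to 1, as \<open>embed_pmf\<close> requires.\<close>

definition index_pmf :: "real \<Rightarrow> ('n::finite \<Rightarrow> real) \<Rightarrow> 'n pmf" where
  "index_pmf H Li = embed_pmf (\<lambda>i. (H + Li i) / total_const H Li)"

text \<open>
  The 5 operations charged besides the partial derivative: the draw, \<open>H + Li i\<close>, its reciprocal,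
  one product, and one subtraction in the only coordinate that changes (\<open>y\<close> is updated in place).
\<close>

definition cd_step ::
  "(real ^ 'n \<Rightarrow> real) \<Rightarrow> real \<Rightarrow> ('n \<Rightarrow> real) \<Rightarrow> ('n \<Rightarrow> real ^ 'n \<Rightarrow> nat) \<Rightarrow>
   (real ^ 'n) \<times> nat \<Rightarrow> ((real ^ 'n) \<times> nat) pmf" where
  "cd_step F H Li cc = (\<lambda>(y, t). do {
     i \<leftarrow> index_pmf H Li;
     return_pmf (y - (1 / (H + Li i) * grad F y $ i) *\<^sub>R axis i 1, t + cc i y + 5)
   })"

primrec cd_loop ::
  "(real ^ 'n \<Rightarrow> real) \<Rightarrow> real \<Rightarrow> ('n \<Rightarrow> real) \<Rightarrow> ('n \<Rightarrow> real ^ 'n \<Rightarrow> nat) \<Rightarrow>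
   nat \<Rightarrow> (real ^ 'n) \<times> nat \<Rightarrow> ((real ^ 'n) \<times> nat) pmf" where
  "cd_loop F H Li cc 0 st = return_pmf st"
| "cd_loop F H Li cc (Suc j) st = cd_loop F H Li cc j st \<bind> cd_step F H Li cc"

text \<open>
  The initial \<open>4 n\<close> operations: \<open>n\<close> sums \<open>H + Li i\<close>, their accumulation into the normalising
  constant, \<open>n\<close> divisions for the probabilities, and copying the starting point.
\<close>

definition coord_descent ::
  "(real ^ 'n \<Rightarrow> real) \<Rightarrow> real \<Rightarrow> ('n \<Rightarrow> real) \<Rightarrow> ('n \<Rightarrow> real ^ 'n \<Rightarrow> nat) \<Rightarrow>
   nat \<Rightarrow> real ^ 'n \<Rightarrow> ((real ^ 'n) \<times> nat) pmf" where
  "coord_descent F H Li cc N y0 = cd_loop F H Li cc N (y0, 4 * CARD('n))"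

text \<open>
  The state is \<open>(A, x, v, t)\<close> with \<open>t\<close> the operations used so far.  Charges: 2 for \<open>lam\<close>
  (recomputed in each iteration), 7 for \<open>a\<close>, 1 for \<open>A'\<close>, \<open>4 n\<close> for \<open>xt\<close>, then the inner method,
  where a partial derivative of the auxiliary objective at \<open>y\<close> is one of \<open>f\<close> plus
  \<open>H * (y $ i - xt $ i)\<close> (3 operations), and finally the gradient at \<open>v'\<close> and \<open>2 n\<close> for the
  update of \<open>x\<close>.
\<close>

definition meta_step ::
  "(real ^ 'n \<Rightarrow> real) \<Rightarrow> real \<Rightarrow> ('n \<Rightarrow> real) \<Rightarrow>
   ('n \<Rightarrow> real ^ 'n \<Rightarrow> nat) \<Rightarrow> (real ^ 'n \<Rightarrow> nat) \<Rightarrow> nat \<Rightarrow>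
   real \<times> (real ^ 'n) \<times> (real ^ 'n) \<times> nat \<Rightarrow> (real \<times> (real ^ 'n) \<times> (real ^ 'n) \<times> nat) pmf" where
  "meta_step f H Li cc gc Nin = (\<lambda>(A, x, v, t).
     let lam = 1 / (2 * H);
         a = (lam + sqrt (lam\<^sup>2 + 4 * lam * A)) / 2;
         A' = A + a;
         xt = (A *\<^sub>R v + a *\<^sub>R x) /\<^sub>R A'
     in do {
       (v', t') \<leftarrow> coord_descent (prox_objective f H xt) H Li (\<lambda>i y. cc i y + 3) Nin xt;
       return_pmf (A', x - a *\<^sub>R grad f v', v',
         t + (10 + 4 * CARD('n)) + t' + (gc v' + 2 * CARD('n)))
     })"

primrec meta_loop ::
  "(real ^ 'n \<Rightarrow> real) \<Rightarrow> real \<Rightarrow> ('n \<Rightarrow> real) \<Rightarrow>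
   ('n \<Rightarrow> real ^ 'n \<Rightarrow> nat) \<Rightarrow> (real ^ 'n \<Rightarrow> nat) \<Rightarrow> nat \<Rightarrow> nat \<Rightarrow>
   real ^ 'n \<Rightarrow> (real \<times> (real ^ 'n) \<times> (real ^ 'n) \<times> nat) pmf" where
  "meta_loop f H Li cc gc Nin 0 x0 = return_pmf (0, x0, x0, 0)"
| "meta_loop f H Li cc gc Nin (Suc k) x0 =
     meta_loop f H Li cc gc Nin k x0 \<bind> meta_step f H Li cc gc Nin"

definition meta_algorithm ::
  "(real ^ 'n \<Rightarrow> real) \<Rightarrow> real \<Rightarrow> ('n \<Rightarrow> real) \<Rightarrow>
   ('n \<Rightarrow> real ^ 'n \<Rightarrow> nat) \<Rightarrow> (real ^ 'n \<Rightarrow> nat) \<Rightarrow> nat \<Rightarrow> nat \<Rightarrow>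
   real ^ 'n \<Rightarrow> ((real ^ 'n) \<times> nat) pmf" where
  "meta_algorithm f H Li cc gc Nout Nin x0 =
     map_pmf (\<lambda>(A, x, v, t). (v, t)) (meta_loop f H Li cc gc Nin Nout x0)"

definition outer_count :: "real \<Rightarrow> real ^ 'n \<Rightarrow> real ^ 'n \<Rightarrow> real \<Rightarrow> nat" where
  "outer_count H x0 xmin \<epsilon> =
     nat \<lceil>4 * sqrt 15 / 5 * sqrt (H * (norm (x0 - xmin))\<^sup>2 / \<epsilon>)\<rceil>"

definition inner_count :: "real \<Rightarrow> real \<Rightarrow> ('n::finite \<Rightarrow> real) \<Rightarrow> nat \<Rightarrow> real \<Rightarrow> nat" where
  "inner_count H L Li Nout \<delta> =
     nat \<lceil>total_const H Li / H *
       ln (real Nout / \<delta> * (1 + L / H) * (3 + 2 * L / H)\<^sup>2)\<rceil>"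

definition meta_run ::
  "(real ^ 'n \<Rightarrow> real) \<Rightarrow> real \<Rightarrow> real \<Rightarrow> ('n \<Rightarrow> real) \<Rightarrow>
   ('n \<Rightarrow> real ^ 'n \<Rightarrow> nat) \<Rightarrow> (real ^ 'n \<Rightarrow> nat) \<Rightarrow>
   real ^ 'n \<Rightarrow> real ^ 'n \<Rightarrow> real \<Rightarrow> real \<Rightarrow> ((real ^ 'n) \<times> nat) pmf" where
  "meta_run f H L Li cc gc x0 xmin \<epsilon> \<delta> =
     (let Nout = outer_count H x0 xmin \<epsilon>
      in meta_algorithm f H Li cc gc Nout (inner_count H L Li Nout \<delta>) x0)"

text \<open>
  The constant hidden in the complexity bound.  A constant obtained existentially in a statement
  about \<open>real ^ 'n\<close> could depend on the dimension, since the type variable is universally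
  quantified at the outside; hence a fixed number, chosen generously.
\<close>

definition abs_const :: real where
  "abs_const = 1000"

end

theory Submission
  imports Defs
begin

text \<open>
  Each auxiliary objective \<open>F\<close> is \<open>H\<close>-strongly convex, and its \<open>i\<close>-th partial derivative is
  \<open>(H + Li i)\<close>-Lipschitz along the \<open>i\<close>-th axis.  A coordinate step with index \<open>i\<close> therefore
  decreases \<open>F\<close> by \<open>(\<nabla>\<^sub>i F)\<^sup>2 / (2 (H + Li i))\<close>; averaged over the index distribution this is
  \<open>\<parallel>\<nabla>F\<parallel>\<^sup>2 / (2 Z)\<close>, so the expected gap contracts by \<open>1 - H / Z\<close> per step.  By Markov's inequality,
  \<open>N\<^sub>\<delta>\<close> steps shrink the gap by \<open>(1 + L / H) (3 + 2 L / H)\<^sup>2\<close> except with probability \<open>\<delta> / N\<close>, and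
  this suffices for the relative error condition \<open>\<parallel>\<nabla>F y\<parallel> \<le> H / 2 \<parallel>y - xt\<parallel>\<close> of
  Monteiro and Svaiter.  Whenever that condition holds, the potential
  \<open>A (f v - f xmin) + \<parallel>x - xmin\<parallel>\<^sup>2 / 2\<close> does not increase in an outer step, while \<open>A\<close> after \<open>k\<close>
  steps is at least \<open>k\<^sup>2 / (8 H)\<close>; a union bound over the outer steps gives the accuracy.

  For the cost, \<open>H\<close> being the mean of the coordinate constants makes \<open>Z / H = 2 n\<close>, so an inner run
  takes \<open>O(n log(1 / (sqrt \<epsilon> \<delta>)))\<close> coordinate steps, because the logarithm eventually dominates
  every logarithm of the problem parameters.
\<close>

section \<open>First-order calculus in inner product spaces\<close>

subsection \<open>Gradients\<close>

lemma GDERIV_unique: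
  assumes "GDERIV f x :> v" "GDERIV f x :> w"
  shows "v = w"
proof -
  have "(\<lambda>h. h \<bullet> v) = (\<lambda>h. h \<bullet> w)"
    using assms has_derivative_unique unfolding gderiv_def by blast
  then have "(v - w) \<bullet> v = (v - w) \<bullet> w"
    by meson
  then have "(v - w) \<bullet> (v - w) = 0"
    by (simp add: inner_diff_right)
  then show ?thesis
    by simp
qed

text \<open>Riesz representation: the values of the derivative on the orthonormal basis are the
  coordinates of the gradient. As \<open>grad\<close> is a definite description, existence and
  uniqueness must both be shown before it can be used.\<close>

lemma GDERIV_grad:
  fixes f :: "real ^ 'n \<Rightarrow> real"
  assumes "f differentiable (at x)"
  shows "GDERIV f x :> grad f x"
proof -
  obtain D where D: "(f has_derivative D) (at x)"
    using assms by (auto simp: differentiable_def)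
  interpret linear D
    using D by (rule has_derivative_linear)
  have "D = (\<lambda>h. h \<bullet> (\<Sum>b\<in>Basis. D b *\<^sub>R b))"
  proof
    fix h
    have "D h = D (\<Sum>b\<in>Basis. (h \<bullet> b) *\<^sub>R b)"
      by (simp add: euclidean_representation)
    also have "\<dots> = h \<bullet> (\<Sum>b\<in>Basis. D b *\<^sub>R b)"
      by (simp add: sum scale inner_sum_right mult.commute)
    finally show "D h = h \<bullet> (\<Sum>b\<in>Basis. D b *\<^sub>R b)" .
  qed
  then have ex: "GDERIV f x :> (\<Sum>b\<in>Basis. D b *\<^sub>R b)"
    using D by (simp add: gderiv_def)
  show ?thesis
    unfolding grad_def by (rule theI, rule ex) (rule GDERIV_unique[OF _ ex])
qed

lemma grad_eqI:
  fixes f :: "real ^ 'n \<Rightarrow> real"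
  assumes "GDERIV f x :> g"
  shows "grad f x = g"
  unfolding grad_def by (rule the_equality, rule assms) (rule GDERIV_unique[OF _ assms])

lemma DERIV_along_line:
  fixes f :: "'a::real_inner \<Rightarrow> real"
  assumes "\<And>x. GDERIV f x :> g x"
  shows "((\<lambda>t. f (x + t *\<^sub>R d)) has_real_derivative (g (x + t *\<^sub>R d) \<bullet> d)) (at t)"
proof -
  have "((\<lambda>t. x + t *\<^sub>R d) has_derivative (\<lambda>h. h *\<^sub>R d)) (at t)"
    by (auto intro!: derivative_eq_intros)
  moreover have "(f has_derivative (\<lambda>h. h \<bullet> g (x + t *\<^sub>R d))) (at (x + t *\<^sub>R d))"
    using assms by (simp add: gderiv_def)
  ultimately have "((\<lambda>t. f (x + t *\<^sub>R d)) has_derivative (\<lambda>h. (h *\<^sub>R d) \<bullet> g (x + t *\<^sub>R d))) (at t)"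
    by (rule has_derivative_compose)
  then show ?thesis
    by (simp add: has_field_derivative_def inner_commute mult.commute[of _ "inner _ _"])
qed

text \<open>Only the growth of the slope along \<open>d\<close> is assumed, so one lemma serves both
  kinds of smoothness: \<open>M\<close> becomes \<open>L * (norm d)^2\<close> for the full gradient
  and \<open>Li i * u^2\<close> along an axis.\<close>

lemma quadratic_upper_bound:
  fixes f :: "'a::real_inner \<Rightarrow> real"
  assumes g: "\<And>x. GDERIV f x :> g x"
    and M: "\<And>t. 0 \<le> t \<Longrightarrow> t \<le> 1 \<Longrightarrow> (g (x + t *\<^sub>R d) - g x) \<bullet> d \<le> M * t"
  shows "f (x + d) \<le> f x + g x \<bullet> d + M / 2"
proof -
  \<comment> \<open>Subtracting the linear term and the quadratic leaves a function whose derivative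
    on [0, 1] is nonpositive by \<open>M\<close>.\<close>
  define \<psi> where "\<psi> t = f (x + t *\<^sub>R d) - t * (g x \<bullet> d) - M * t\<^sup>2 / 2" for t
  have "(\<psi> has_real_derivative (g (x + t *\<^sub>R d) - g x) \<bullet> d - M * t) (at t)" for t
    unfolding \<psi>_def
    by (auto intro!: derivative_eq_intros DERIV_along_line[OF g] simp: inner_diff_left)
  then have "\<psi> 1 \<le> \<psi> 0"
    using M by (intro DERIV_nonpos_imp_nonincreasing[of 0 1 \<psi>]) fastforce+
  then show ?thesis
    by (simp add: \<psi>_def)
qed

text \<open>Restricting \<open>f\<close> to the line through \<open>x\<close> and \<open>y\<close>
  reduces this to the tangent inequality for convex functions of one variable.\<close>

lemma convex_on_above_gradient:
  fixes f :: "'a::real_inner \<Rightarrow> real"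
  assumes g: "\<And>x. GDERIV f x :> g x" and convex: "convex_on UNIV f"
  shows "f x + g x \<bullet> (y - x) \<le> f y"
proof -
  let ?\<phi> = "\<lambda>t::real. f (x + t *\<^sub>R (y - x))"
  have "convex_on UNIV ?\<phi>"
  proof (rule convex_onI)
    fix t a b :: real assume t: "0 < t" "t < 1"
    have "x + ((1 - t) *\<^sub>R a + t *\<^sub>R b) *\<^sub>R (y - x)
        = (1 - t) *\<^sub>R (x + a *\<^sub>R (y - x)) + t *\<^sub>R (x + b *\<^sub>R (y - x))"
      by (simp add: algebra_simps)
    then show "?\<phi> ((1 - t) *\<^sub>R a + t *\<^sub>R b) \<le> (1 - t) * ?\<phi> a + t * ?\<phi> b"
      using convex_onD[OF convex, of t] t by simp
  qed auto
  then have "(g (x + 0 *\<^sub>R (y - x)) \<bullet> (y - x)) * (1 - 0) \<le> ?\<phi> 1 - ?\<phi> 0"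
    by (rule convex_on_imp_above_tangent) (use DERIV_along_line[OF g, of x "y - x" 0] in auto)
  then show ?thesis
    by simp
qed

subsection \<open>Coordinate descent\<close>

lemma pmf_index_pmf:
  fixes Li :: "'n::finite \<Rightarrow> real"
  assumes "H > 0" "\<And>i. Li i \<ge> 0"
  shows "pmf (index_pmf H Li) i = (H + Li i) / total_const H Li"
proof -
  have pos: "total_const H Li > 0"
    unfolding total_const_def using assms by (intro sum_pos) (auto intro: add_pos_nonneg)
  have "(\<integral>\<^sup>+x. ennreal ((H + Li x) / total_const H Li) \<partial>count_space UNIV)
      = ennreal (\<Sum>x\<in>UNIV. (H + Li x) / total_const H Li)"
    using assms pos by (subst nn_integral_count_space_finite) (auto intro!: sum_ennreal)
  also have "(\<Sum>x\<in>UNIV. (H + Li x) / total_const H Li) = 1"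
    using pos unfolding total_const_def by (simp flip: sum_divide_distrib)
  finally show ?thesis
    unfolding index_pmf_def using assms pos by (intro pmf_embed_pmf) auto
qed

lemma nn_integral_index_pmf:
  fixes Li :: "'n::finite \<Rightarrow> real"
  assumes "H > 0" "\<And>i. Li i \<ge> 0" "\<And>i. X i \<ge> 0"
  shows "(\<integral>\<^sup>+i. ennreal (X i) \<partial>index_pmf H Li)
    = ennreal ((\<Sum>i\<in>UNIV. (H + Li i) * X i) / total_const H Li)"
proof -
  have pos: "total_const H Li > 0"
    unfolding total_const_def using assms by (intro sum_pos) (auto intro: add_pos_nonneg)
  have "(\<integral>\<^sup>+i. ennreal (X i) \<partial>index_pmf H Li)
      = (\<Sum>i\<in>UNIV. ennreal (pmf (index_pmf H Li) i) * ennreal (X i))"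
    by (simp add: nn_integral_measure_pmf nn_integral_count_space_finite)
  also have "\<dots> = (\<Sum>i\<in>UNIV. ennreal ((H + Li i) * X i / total_const H Li))"
    using assms pos by (simp add: pmf_index_pmf flip: ennreal_mult')
  also have "\<dots> = ennreal (\<Sum>i\<in>UNIV. (H + Li i) * X i / total_const H Li)"
    using assms pos by (intro sum_ennreal) auto
  finally show ?thesis
    by (simp add: sum_divide_distrib)
qed

text \<open>Markov's inequality with threshold \<open>c\<close>. The case \<open>c = 0\<close>
  arises when coordinate descent starts at a minimizer; there the integral vanishes and the bound
  holds almost surely.\<close>

lemma prob_ge_of_nn_integral_le:
  fixes X :: "'a \<Rightarrow> real"
  assumes int: "(\<integral>\<^sup>+x. ennreal (X x) \<partial>measure_pmf M) \<le> ennreal (q * c)"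
    and "q > 0" "c \<ge> 0"
  shows "measure_pmf.prob M {x. X x \<le> c} \<ge> 1 - q"
proof (cases "c = 0")
  case True
  then have "AE x in measure_pmf M. ennreal (X x) = 0"
    using int by (simp add: nn_integral_0_iff_AE)
  then have "AE x in measure_pmf M. x \<in> {x. X x \<le> c}"
    using True by (auto elim!: AE_mp simp: ennreal_eq_0_iff)
  then have "measure_pmf.prob M {x. X x \<le> c} = 1"
    by (subst measure_pmf.prob_eq_1) auto
  then show ?thesis
    using assms by simp
next
  case False
  then have "c > 0"
    using assms by simp
  have "emeasure (measure_pmf M) {x. \<not> X x \<le> c}
      \<le> emeasure (measure_pmf M) {x\<in>UNIV. 1 \<le> ennreal (1 / c) * ennreal (X x)}"
  proof (rule emeasure_mono)
    show "{x. \<not> X x \<le> c} \<subseteq> {x\<in>UNIV. 1 \<le> ennreal (1 / c) * ennreal (X x)}"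
      using \<open>c > 0\<close> by (auto simp flip: ennreal_mult' simp: ennreal_1[symmetric] ennreal_leI simp del: ennreal_1)
  qed auto
  also have "\<dots> \<le> ennreal (1 / c) * (\<integral>\<^sup>+x. ennreal (X x) * indicator UNIV x \<partial>measure_pmf M)"
    by (rule nn_integral_Markov_inequality) auto
  also have "\<dots> \<le> ennreal (1 / c) * ennreal (q * c)"
    using int by (intro mult_left_mono) auto
  also have "\<dots> = ennreal q"
    using \<open>c > 0\<close> assms by (simp flip: ennreal_mult')
  finally have "measure_pmf.prob M {x. \<not> X x \<le> c} \<le> q"
    using assms by (simp add: measure_pmf.emeasure_eq_measure)
  moreover have "measure_pmf.prob M {x. \<not> X x \<le> c} = 1 - measure_pmf.prob M {x. X x \<le> c}"
    using measure_pmf.prob_compl[of "{x. X x \<le> c}" M] by (simp add: Compl_eq_Diff_UNIV[symmetric] Collect_neg_eq)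
  ultimately show ?thesis
    by simp
qed

text \<open>The union bound along a Markov chain; no independence is needed.\<close>

lemma prob_bind_pmf_ge:
  assumes M: "measure_pmf.prob M A \<ge> 1 - p"
    and K: "\<And>x. x \<in> A \<Longrightarrow> measure_pmf.prob (K x) B \<ge> 1 - q"
    and "0 \<le> p" "0 \<le> q"
  shows "measure_pmf.prob (M \<bind> K) B \<ge> 1 - (p + q)"
proof -
  \<comment> \<open>For \<open>q\<close> at most 1 this is the product (1 - q)(1 - p) with the term
    \<open>p * q\<close> dropped; for larger \<open>q\<close> the factor is negative, and the
    probability is bounded by 1 instead.\<close>
  have "1 - (p + q) \<le> (1 - q) * measure_pmf.prob M A"
  proof (cases "q \<le> 1")
    case True
    have "1 - (p + q) \<le> (1 - q) * (1 - p)"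
      using assms(3,4) by (simp add: algebra_simps)
    also have "\<dots> \<le> (1 - q) * measure_pmf.prob M A"
      using M True by (intro mult_left_mono) auto
    finally show ?thesis .
  next
    case False
    have "1 - (p + q) \<le> (1 - q) * 1"
      using assms(3) by simp
    also have "\<dots> \<le> (1 - q) * measure_pmf.prob M A"
      using False by (intro mult_left_mono_neg) auto
    finally show ?thesis .
  qed
  also have "\<dots> = measure_pmf.expectation M (\<lambda>x. (1 - q) * indicator A x)"
    by simp
  also have "\<dots> \<le> measure_pmf.expectation M (\<lambda>x. measure_pmf.prob (K x) B)"
  proof (rule integral_mono)
    show "integrable M (\<lambda>x. measure_pmf.prob (K x) B)"
      by (rule measure_pmf.integrable_const_bound[where B = 1]) auto
    show "integrable M (\<lambda>x. (1 - q) * indicator A x)"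
      by (intro integrable_mult_right measure_pmf.integrable_const_bound[where B = 1]) auto
  next
    fix x
    show "(1 - q) * indicator A x \<le> measure_pmf.prob (K x) B"
      using K[of x] by (auto simp: indicator_def)
  qed
  also have "\<dots> = measure_pmf.prob (M \<bind> K) B"
    using measurable_measure_pmf[of K]
    by (simp add: measure_pmf_bind measure_pmf.measure_bind[where N="count_space UNIV"])
  finally show ?thesis .
qed


section \<open>Linear convergence of randomised coordinate descent\<close>

lemma sum_squares_vec_nth:
  fixes v :: "real ^ 'n"
  shows "(\<Sum>i\<in>UNIV. (v $ i)\<^sup>2) = (norm v)\<^sup>2"
  unfolding power2_norm_eq_inner inner_vec_def by (simp add: power2_eq_square)

text \<open>Isolates the two quadratic bounds that drive the contraction. Each outer iteration has
  its own auxiliary objective and minimizer \<open>ys\<close>, for which the locale is interpreted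
  anew.\<close>

locale strongly_convex_coordinate_smooth =
  fixes F :: "real ^ 'n \<Rightarrow> real" and H :: real and Li :: "'n \<Rightarrow> real" and ys :: "real ^ 'n"
  assumes H_pos: "H > 0"
    and Li_nonneg: "Li i \<ge> 0"
    and strongly_convex: "F y + grad F y \<bullet> (z - y) + H / 2 * (norm (z - y))\<^sup>2 \<le> F z"
    and coordinate_smooth: "F (y + u *\<^sub>R axis i 1) \<le> F y + u * grad F y $ i + (H + Li i) / 2 * u\<^sup>2"
    and minimizer: "F ys \<le> F y"
begin

lemma gradient_dominance: "2 * H * (F y - F ys) \<le> (norm (grad F y))\<^sup>2"
proof -
  let ?g = "grad F y" and ?d = "ys - y"
  \<comment> \<open>minimising the quadratic lower bound of strong convexity over all displacements\<close>
  have "0 \<le> (norm (?g + H *\<^sub>R ?d))\<^sup>2"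
    by simp
  also have "\<dots> = (norm ?g)\<^sup>2 + 2 * H * (?g \<bullet> ?d) + H\<^sup>2 * (norm ?d)\<^sup>2"
    unfolding power2_norm_eq_inner
    by (simp add: inner_add_left inner_add_right inner_commute power2_eq_square algebra_simps)
  also have "\<dots> = (norm ?g)\<^sup>2 + 2 * H * (?g \<bullet> ?d + H / 2 * (norm ?d)\<^sup>2)"
    by (simp add: power2_eq_square algebra_simps)
  also have "\<dots> \<le> (norm ?g)\<^sup>2 + 2 * H * (F ys - F y)"
    using strongly_convex[of y ys] H_pos by (intro add_left_mono mult_left_mono) auto
  finally show ?thesis
    by (simp add: algebra_simps)
qed

text \<open>Makes the contraction factor \<open>1 - H / total_const H Li\<close> nonnegative, so
  that it can be iterated and raised to powers.\<close>

lemma total_const_ge: "H \<le> total_const H Li"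
proof -
  have "H + Li i \<le> total_const H Li" for i
    unfolding total_const_def using H_pos Li_nonneg
    by (intro member_le_sum) (auto intro: add_nonneg_nonneg order.strict_implies_order)
  then show ?thesis
    using Li_nonneg by (meson le_add_same_cancel1 order_trans)
qed

text \<open>The step length 1 / (H + Li i) minimizes the quadratic upper bound along the axis, and
  the stated decrease is the value of that minimum.\<close>

lemma coordinate_step_decrease:
  "F (y - (1 / (H + Li i) * grad F y $ i) *\<^sub>R axis i 1) \<le> F y - (grad F y $ i)\<^sup>2 / (2 * (H + Li i))"
proof -
  have pos: "H + Li i > 0"
    using H_pos Li_nonneg[of i] by simp
  have "F (y - (1 / (H + Li i) * grad F y $ i) *\<^sub>R axis i 1)
      \<le> F y + (- (1 / (H + Li i) * grad F y $ i)) * grad F y $ i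
         + (H + Li i) / 2 * (- (1 / (H + Li i) * grad F y $ i))\<^sup>2"
    using coordinate_smooth[of y "- (1 / (H + Li i) * grad F y $ i)" i] by simp
  also have "\<dots> = F y - (grad F y $ i)\<^sup>2 / (2 * (H + Li i))"
  proof -
    have "- (1 / m * g) * g + m / 2 * (- (1 / m * g))\<^sup>2 = - (g\<^sup>2 / (2 * m))" if "m > 0" for m g :: real
      using that by (simp add: field_simps power2_eq_square)
    from this[OF pos, of "grad F y $ i"] show ?thesis
      by simp
  qed
  finally show ?thesis .
qed

lemma cd_step_contraction:
  "(\<integral>\<^sup>+(y', t'). ennreal (F y' - F ys) \<partial>cd_step F H Li cc (y, t))
    \<le> ennreal ((1 - H / total_const H Li) * (F y - F ys))"
proof -
  let ?Z = "total_const H Li"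
  let ?y = "\<lambda>i. y - (1 / (H + Li i) * grad F y $ i) *\<^sub>R axis i 1"
  have Z: "?Z > 0"
    using total_const_ge H_pos by simp
  have "(\<integral>\<^sup>+(y', t'). ennreal (F y' - F ys) \<partial>cd_step F H Li cc (y, t))
      = (\<integral>\<^sup>+i. ennreal (F (?y i) - F ys) \<partial>index_pmf H Li)"
    by (simp add: cd_step_def)
  also have "\<dots> = ennreal ((\<Sum>i\<in>UNIV. (H + Li i) * (F (?y i) - F ys)) / ?Z)"
    using H_pos Li_nonneg minimizer by (intro nn_integral_index_pmf) auto
  also have "\<dots> \<le> ennreal ((1 - H / ?Z) * (F y - F ys))"
  proof (rule ennreal_leI)
    \<comment> \<open>Sampling proportionally to \<open>H + Li i\<close> cancels the denominators of
      the individual decreases, so the squared partial derivatives add up to the squared gradient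
      norm.\<close>
    have "(\<Sum>i\<in>UNIV. (H + Li i) * (F (?y i) - F ys))
        \<le> (\<Sum>i\<in>UNIV. (H + Li i) * (F y - F ys) - (grad F y $ i)\<^sup>2 / 2)"
    proof (rule sum_mono)
      fix i
      have pos: "H + Li i > 0"
        using H_pos Li_nonneg[of i] by simp
      have "(H + Li i) * (F (?y i) - F ys)
          \<le> (H + Li i) * (F y - (grad F y $ i)\<^sup>2 / (2 * (H + Li i)) - F ys)"
        using coordinate_step_decrease[of y i] pos by (intro mult_left_mono) auto
      also have "\<dots> = (H + Li i) * (F y - F ys) - (grad F y $ i)\<^sup>2 / 2"
        using pos by (simp add: field_simps)
      finally show "(H + Li i) * (F (?y i) - F ys)
          \<le> (H + Li i) * (F y - F ys) - (grad F y $ i)\<^sup>2 / 2" .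
    qed
    also have "\<dots> = ?Z * (F y - F ys) - (norm (grad F y))\<^sup>2 / 2"
      unfolding total_const_def
      by (simp only: sum_subtractf sum_distrib_right[symmetric] sum_divide_distrib[symmetric] sum_squares_vec_nth)
    also have "\<dots> \<le> ?Z * (F y - F ys) - H * (F y - F ys)"
      using gradient_dominance[of y] by simp
    finally show "(\<Sum>i\<in>UNIV. (H + Li i) * (F (?y i) - F ys)) / ?Z \<le> (1 - H / ?Z) * (F y - F ys)"
      using Z by (simp add: field_simps)
  qed
  finally show ?thesis .
qed

lemma cd_loop_contraction:
  "(\<integral>\<^sup>+(y', t'). ennreal (F y' - F ys) \<partial>cd_loop F H Li cc N (y, t))
    \<le> ennreal ((1 - H / total_const H Li) ^ N * (F y - F ys))"
proof (induction N)
  case (Suc N)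
  let ?r = "1 - H / total_const H Li"
  have r: "?r \<ge> 0"
    using total_const_ge H_pos by simp
  have "(\<integral>\<^sup>+(y', t'). ennreal (F y' - F ys) \<partial>cd_loop F H Li cc (Suc N) (y, t))
      = (\<integral>\<^sup>+s. \<integral>\<^sup>+(y', t'). ennreal (F y' - F ys) \<partial>cd_step F H Li cc s \<partial>cd_loop F H Li cc N (y, t))"
    by simp
  \<comment> \<open>Conditioning on the state after \<open>N\<close> steps: the one-step contraction
    applies to each such state.\<close>
  also have "\<dots> \<le> (\<integral>\<^sup>+s. ennreal ?r * (case s of (y', t') \<Rightarrow> ennreal (F y' - F ys)) \<partial>cd_loop F H Li cc N (y, t))"
    using cd_step_contraction r minimizer
    by (intro nn_integral_mono) (auto simp: ennreal_mult' split: prod.split)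
  also have "\<dots> = ennreal ?r * (\<integral>\<^sup>+(y', t'). ennreal (F y' - F ys) \<partial>cd_loop F H Li cc N (y, t))"
    by (rule nn_integral_cmult) auto
  also have "\<dots> \<le> ennreal ?r * ennreal (?r ^ N * (F y - F ys))"
    using Suc by (intro mult_left_mono) auto
  also have "\<dots> = ennreal (?r ^ Suc N * (F y - F ys))"
    using r by (simp add: mult.assoc flip: ennreal_mult')
  finally show ?case .
qed simp

text \<open>By 1 - u <= exp (-u), the expected gap after \<open>N\<close> steps is at most
  \<open>q / c\<close> times the initial one; Markov's inequality then trades the factor
  \<open>q\<close> for the failure probability.\<close>

lemma coord_descent_gap:
  assumes "q > 0" "c > 0" and N: "total_const H Li / H * ln (c / q) \<le> real N"
  shows "measure_pmf.prob (coord_descent F H Li cc N y)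
    {(y', t'). F y' - F ys \<le> (F y - F ys) / c} \<ge> 1 - q"
proof -
  let ?Z = "total_const H Li"
  have Z: "?Z > 0" "H / ?Z \<le> 1"
    using total_const_ge H_pos by simp_all
  have gap: "F y - F ys \<ge> 0"
    using minimizer by simp
  have "(1 - H / ?Z) ^ N \<le> exp (- (H / ?Z)) ^ N"
    using exp_ge_add_one_self[of "- (H / ?Z)"] Z by (intro power_mono) auto
  also have "\<dots> = exp (- (real N * (H / ?Z)))"
    by (simp flip: exp_of_nat_mult)
  also have "\<dots> \<le> exp (- ln (c / q))"
    using N H_pos Z by (simp add: field_simps)
  also have "\<dots> = q / c"
    using assms by (simp add: exp_minus)
  finally have "(1 - H / ?Z) ^ N * (F y - F ys) \<le> q / c * (F y - F ys)"
    using gap by (rule mult_right_mono)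
  then have "(1 - H / ?Z) ^ N * (F y - F ys) \<le> q * ((F y - F ys) / c)"
    by simp
  then have "(\<integral>\<^sup>+s. ennreal (F (fst s) - F ys) \<partial>coord_descent F H Li cc N y)
      \<le> ennreal (q * ((F y - F ys) / c))"
    using cd_loop_contraction[of cc N y "4 * CARD('n)"]
    unfolding coord_descent_def case_prod_unfold
    by (meson ennreal_leI order_trans)
  then have "measure_pmf.prob (coord_descent F H Li cc N y)
      {s. F (fst s) - F ys \<le> (F y - F ys) / c} \<ge> 1 - q"
    using assms gap by (intro prob_ge_of_nn_integral_le) auto
  then show ?thesis
    by (simp add: case_prod_unfold)
qed

end

text \<open>The iteration count is fixed in advance, so the bound holds for every outcome in the
  support and not merely on average.\<close>

lemma cd_loop_cost:
  assumes "\<And>i y. real (cc i y) \<le> C" and "s \<in> set_pmf (cd_loop F H Li cc N (y, t))"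
  shows "real (snd s) \<le> real t + real N * (C + 5)"
  using assms(2)
proof (induction N arbitrary: s)
  case (Suc N)
  from Suc.prems obtain s' where s': "s' \<in> set_pmf (cd_loop F H Li cc N (y, t))"
    and "s \<in> set_pmf (cd_step F H Li cc s')"
    by auto
  then obtain i where "snd s = snd s' + cc i (fst s') + 5"
    by (auto simp: cd_step_def split: prod.splits)
  then show ?case
    using Suc.IH[OF s'] assms(1)[of i "fst s'"] by (simp add: algebra_simps)
qed auto


subsection \<open>The outer iteration\<close>

locale smooth_convex =
  fixes f :: "real ^ 'n \<Rightarrow> real" and L :: real and Li :: "'n \<Rightarrow> real" and xmin :: "real ^ 'n"
  assumes differentiable: "f differentiable_on UNIV"
    and convex: "convex_on UNIV f"
    and minimizer: "f xmin \<le> f x"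
    and lipschitz: "L-lipschitz_on UNIV (grad f)"
    and coordinate_lipschitz: "\<bar>grad f (x + u *\<^sub>R axis i 1) $ i - grad f x $ i\<bar> \<le> Li i * \<bar>u\<bar>"
begin

section \<open>First-order bounds from smoothness and convexity\<close>

lemma L_nonneg: "L \<ge> 0"
  using lipschitz by (rule lipschitz_on_nonneg)

lemma Li_nonneg: "Li i \<ge> 0"
  using coordinate_lipschitz[of 0 1 i] by simp

lemma has_grad: "GDERIV f x :> grad f x"
  using differentiable by (intro GDERIV_grad) (simp add: differentiable_on_def)

lemma grad_lipschitz: "norm (grad f y - grad f x) \<le> L * norm (y - x)"
  using lipschitz_onD[OF lipschitz] by (simp add: dist_norm)

lemma smooth: "f (x + d) \<le> f x + grad f x \<bullet> d + L / 2 * (norm d)\<^sup>2"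
proof -
  have "f (x + d) \<le> f x + grad f x \<bullet> d + (L * (norm d)\<^sup>2) / 2"
  proof (rule quadratic_upper_bound[OF has_grad])
    fix t :: real assume t: "0 \<le> t" "t \<le> 1"
    have "(grad f (x + t *\<^sub>R d) - grad f x) \<bullet> d \<le> norm (grad f (x + t *\<^sub>R d) - grad f x) * norm d"
      by (rule norm_cauchy_schwarz)
    also have "\<dots> \<le> (L * (t * norm d)) * norm d"
      using grad_lipschitz[of "x + t *\<^sub>R d" x] t by (intro mult_right_mono) auto
    finally show "(grad f (x + t *\<^sub>R d) - grad f x) \<bullet> d \<le> L * (norm d)\<^sup>2 * t"
      by (simp add: power2_eq_square mult_ac)
  qed
  then show ?thesis
    by simp
qed

lemma coordinate_smooth: "f (x + u *\<^sub>R axis i 1) \<le> f x + u * grad f x $ i + Li i / 2 * u\<^sup>2"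
proof -
  have "f (x + u *\<^sub>R axis i 1) \<le> f x + grad f x \<bullet> (u *\<^sub>R axis i 1) + (Li i * u\<^sup>2) / 2"
  proof (rule quadratic_upper_bound[OF has_grad])
    fix t :: real assume t: "0 \<le> t" "t \<le> 1"
    let ?d = "grad f (x + t *\<^sub>R u *\<^sub>R axis i 1) - grad f x"
    have "?d \<bullet> (u *\<^sub>R axis i 1) = u * ?d $ i"
      by (simp add: inner_axis)
    also have "\<dots> \<le> \<bar>u\<bar> * \<bar>?d $ i\<bar>"
      by (metis abs_ge_self abs_mult)
    also have "\<dots> \<le> \<bar>u\<bar> * (Li i * \<bar>t * u\<bar>)"
      using coordinate_lipschitz[of x "t * u" i] by (intro mult_left_mono) auto
    also have "\<dots> = Li i * u\<^sup>2 * t"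
      using t by (simp add: abs_mult power2_eq_square mult_ac)
    finally show "?d \<bullet> (u *\<^sub>R axis i 1) \<le> Li i * u\<^sup>2 * t" .
  qed
  then show ?thesis
    by (simp add: inner_axis)
qed

lemma above_gradient: "f x + grad f x \<bullet> (y - x) \<le> f y"
  by (rule convex_on_above_gradient[OF has_grad convex])

section \<open>The regularised auxiliary problem and its approximate solutions\<close>

lemma GDERIV_prox_objective:
  "GDERIV (prox_objective f H xt) y :> grad f y + H *\<^sub>R (y - xt)"
proof -
  have "((\<lambda>y. f y + H / 2 * ((y - xt) \<bullet> (y - xt))) has_derivative
      (\<lambda>h. h \<bullet> grad f y + H / 2 * ((y - xt) \<bullet> h + h \<bullet> (y - xt)))) (at y)"
    using has_grad[of y] unfolding gderiv_def by (auto intro!: derivative_eq_intros)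
  then show ?thesis
    unfolding gderiv_def prox_objective_def power2_norm_eq_inner
    by (simp add: inner_add_right inner_commute)
qed

lemma grad_prox_objective: "grad (prox_objective f H xt) y = grad f y + H *\<^sub>R (y - xt)"
  by (rule grad_eqI[OF GDERIV_prox_objective])

text \<open>The quadratic regulariser differs from its linearisation by exactly
  \<open>H / 2 * (norm (z - y))^2\<close>. Every bound on \<open>f\<close> around its tangent
  therefore carries over to the auxiliary objective with \<open>H\<close> added to the
  curvature.\<close>

lemma prox_objective_diff:
  "prox_objective f H xt z - prox_objective f H xt y - grad (prox_objective f H xt) y \<bullet> (z - y)
    = f z - f y - grad f y \<bullet> (z - y) + H / 2 * (norm (z - y))\<^sup>2"
  unfolding prox_objective_def grad_prox_objective power2_norm_eq_inner
  by (simp add: inner_add_left inner_diff_left inner_diff_right inner_commute algebra_simps)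

lemma prox_objective_minimizer:
  assumes "H > 0"
  obtains ys where "\<And>y. prox_objective f H xt ys \<le> prox_objective f H xt y"
proof -
  let ?F = "prox_objective f H xt"
  \<comment> \<open>Chosen so that outside the ball the regulariser alone exceeds
    \<open>f xt - f xmin\<close>; there the objective is at least its value at the centre, and
    compactness of the ball yields a minimizer.\<close>
  define r where "r = sqrt (2 / H * (f xt - f xmin))"
  have r: "r \<ge> 0" "H / 2 * r\<^sup>2 = f xt - f xmin"
    using assms minimizer[of xt] by (auto simp: r_def)
  have "continuous_on (cball xt r) ?F"
    using GDERIV_prox_objective[of H xt] unfolding gderiv_def
    by (intro has_derivative_continuous_on) (auto intro: has_derivative_at_withinI)
  then obtain ys where ys: "ys \<in> cball xt r" "\<And>y. y \<in> cball xt r \<Longrightarrow> ?F ys \<le> ?F y"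
    using r continuous_attains_inf[of "cball xt r" ?F] by auto
  have "?F ys \<le> ?F y" for y
  proof (cases "y \<in> cball xt r")
    case False
    then have "r\<^sup>2 \<le> (norm (y - xt))\<^sup>2"
      using r by (intro power_mono) (auto simp: dist_norm norm_minus_commute)
    then have "H / 2 * r\<^sup>2 \<le> H / 2 * (norm (y - xt))\<^sup>2"
      using assms by (intro mult_left_mono) auto
    then have "?F xt \<le> ?F y"
      using r(2) minimizer[of y] by (simp add: prox_objective_def)
    moreover have "?F ys \<le> ?F xt"
      using ys r by simp
    ultimately show ?thesis
      by simp
  qed (use ys in auto)
  then show ?thesis
    using that by blast
qed

lemma strongly_convex_prox_objective:
  assumes "H > 0" and ys: "\<And>y. prox_objective f H xt ys \<le> prox_objective f H xt y"
  shows "strongly_convex_coordinate_smooth (prox_objective f H xt) H Li ys"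
proof
  fix y z and u :: real and i
  let ?F = "prox_objective f H xt"
  show "?F y + grad ?F y \<bullet> (z - y) + H / 2 * (norm (z - y))\<^sup>2 \<le> ?F z"
    using prox_objective_diff[of H xt z y] above_gradient[of y z] by simp
  show "?F (y + u *\<^sub>R axis i 1) \<le> ?F y + u * grad ?F y $ i + (H + Li i) / 2 * u\<^sup>2"
    using prox_objective_diff[of H xt "y + u *\<^sub>R axis i 1" y] coordinate_smooth[of y u i]
    by (simp add: inner_axis power_mult_distrib add_divide_distrib distrib_right)
qed (use assms Li_nonneg in auto)

lemma inexact_prox_condition:
  assumes "H > 0" and ys: "\<And>y. prox_objective f H xt ys \<le> prox_objective f H xt y"
    and gap: "prox_objective f H xt y - prox_objective f H xt ys
      \<le> (prox_objective f H xt xt - prox_objective f H xt ys) / ((1 + L / H) * (3 + 2 * L / H)\<^sup>2)"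
  shows "norm (grad f y + H *\<^sub>R (y - xt)) \<le> H / 2 * norm (y - xt)"
proof -
  let ?F = "prox_objective f H xt"
  let ?c = "3 + 2 * L / H"
  interpret strongly_convex_coordinate_smooth ?F H Li ys
    by (rule strongly_convex_prox_objective) fact+
  have "(\<lambda>h. h \<bullet> grad ?F ys) = (\<lambda>h. 0)"
    using GDERIV_prox_objective[of H xt ys] ys
    unfolding grad_prox_objective gderiv_def by (intro differential_zero_maxmin[of ys UNIV ?F]) auto
  then have grad_0: "grad ?F ys = 0"
    by (metis inner_eq_zero_iff)
  have c: "1 + L / H > 0" "?c > 0"
    using \<open>H > 0\<close> L_nonneg by (auto intro: add_pos_nonneg)
  have "H / 2 * (norm (y - ys))\<^sup>2 \<le> ?F y - ?F ys"
    using strongly_convex[of ys y] by (simp add: grad_0)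
  also have "\<dots> \<le> (?F xt - ?F ys) / ((1 + L / H) * ?c\<^sup>2)"
    by (rule gap)
  \<comment> \<open>As the gradient vanishes at \<open>ys\<close>, (L + H)-smoothness bounds the
    initial gap by the squared distance to \<open>ys\<close>.\<close>
  also have "\<dots> \<le> ((L + H) / 2 * (norm (xt - ys))\<^sup>2) / ((1 + L / H) * ?c\<^sup>2)"
    using prox_objective_diff[of H xt xt ys] smooth[of ys "xt - ys"] c
    by (intro divide_right_mono mult_nonneg_nonneg zero_le_power2)
      (auto simp: grad_0 add_divide_distrib distrib_right)
  \<comment> \<open>The factor \<open>1 + L / H\<close> cancels the ratio of smoothness to strong
    convexity; the square of \<open>?c\<close> is left as a reduction of distance by
    \<open>?c\<close>.\<close>
  also have "\<dots> = H / 2 * (norm (xt - ys) / ?c)\<^sup>2"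
  proof -
    have LH: "(L + H) / 2 = H / 2 * (1 + L / H)"
      using \<open>H > 0\<close> by (simp add: field_simps)
    have "H / 2 * p * w\<^sup>2 / (p * d\<^sup>2) = H / 2 * (w / d)\<^sup>2" if "p > 0" "d > 0" for p w d :: real
      using that by (simp add: power_divide)
    from this[OF c] show ?thesis
      unfolding LH .
  qed
  finally have "(norm (y - ys))\<^sup>2 \<le> (norm (xt - ys) / ?c)\<^sup>2"
    using \<open>H > 0\<close> by simp
  then have "norm (y - ys) \<le> norm (xt - ys) / ?c"
    using c by (simp add: power2_le_iff_abs_le)
  then have "?c * norm (y - ys) \<le> norm (xt - ys)"
    using c by (simp add: field_simps)
  also have "\<dots> \<le> norm (y - ys) + norm (y - xt)"
    using norm_triangle_ineq4[of "y - ys" "y - xt"] by simp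
  \<comment> \<open>The triangle inequality costs 1 of the constant 3. What remains,
    \<open>2 + 2 * L / H\<close>, is 2 (L + H) / H, which turns the (L + H)-Lipschitz bound on the
    gradient into the factor \<open>H / 2\<close>.\<close>
  finally have near: "(2 + 2 * L / H) * norm (y - ys) \<le> norm (y - xt)"
    by (simp add: algebra_simps)
  have "norm (grad ?F y) = norm (grad ?F y - grad ?F ys)"
    by (simp add: grad_0)
  also have "\<dots> = norm ((grad f y - grad f ys) + H *\<^sub>R (y - ys))"
    unfolding grad_prox_objective by (simp add: algebra_simps)
  also have "\<dots> \<le> L * norm (y - ys) + H * norm (y - ys)"
    using grad_lipschitz[of y ys] \<open>H > 0\<close> by (intro norm_triangle_mono) auto
  also have "\<dots> = H / 2 * ((2 + 2 * L / H) * norm (y - ys))"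
    using \<open>H > 0\<close> by (simp add: field_simps)
  also have "\<dots> \<le> H / 2 * norm (y - xt)"
    using near \<open>H > 0\<close> by (intro mult_left_mono) auto
  finally show ?thesis
    by (simp add: grad_prox_objective)
qed

section \<open>The potential argument for the accelerated iteration\<close>

lemma potential_step:
  assumes "H > 0" "A \<ge> 0" "A + a > 0" and a: "2 * H * a\<^sup>2 = A + a" and "a \<ge> 0"
    and xt: "xt = (A *\<^sub>R v + a *\<^sub>R x) /\<^sub>R (A + a)"
    and inexact: "norm (grad f y + H *\<^sub>R (y - xt)) \<le> H / 2 * norm (y - xt)"
  shows "(A + a) * (f y - f xmin) + (norm (x - a *\<^sub>R grad f y - xmin))\<^sup>2 / 2
    \<le> A * (f v - f xmin) + (norm (x - xmin))\<^sup>2 / 2"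
proof -
  let ?g = "grad f y"
  have "(norm (?g + H *\<^sub>R (y - xt)))\<^sup>2 \<le> (H / 2 * norm (y - xt))\<^sup>2"
    using inexact by (intro power_mono) auto
  then have "(norm ?g)\<^sup>2 + 2 * H * (?g \<bullet> (y - xt)) + H\<^sup>2 * (norm (y - xt))\<^sup>2 \<le> H\<^sup>2 / 4 * (norm (y - xt))\<^sup>2"
    unfolding power2_norm_eq_inner power_mult_distrib
    by (simp add: inner_add_left inner_add_right inner_commute power2_eq_square algebra_simps)
  moreover have "H\<^sup>2 * (norm (y - xt))\<^sup>2 \<ge> 0"
    by simp
  ultimately have "2 * H * (?g \<bullet> (y - xt)) + (norm ?g)\<^sup>2 \<le> 0"
    by argo
  \<comment> \<open>Doubling the previous inequality leaves a spare squared gradient norm to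
    discard. The coefficient 4 H matches \<open>a\<close>, since A + a = 2 H a^2.\<close>
  then have descent: "4 * H * (?g \<bullet> (y - xt)) + (norm ?g)\<^sup>2 \<le> 0"
    using zero_le_power2[of "norm ?g"] by linarith
  have "(A + a) *\<^sub>R xt = A *\<^sub>R v + a *\<^sub>R x"
    using xt \<open>A + a > 0\<close> by simp
  then have comb: "(A + a) * (?g \<bullet> xt) = A * (?g \<bullet> v) + a * (?g \<bullet> x)"
    by (metis inner_add_right inner_scaleR_right)
  \<comment> \<open>The tangent at the new point \<open>y\<close> is tested against the previous
    output \<open>v\<close> with weight \<open>A\<close> and against the minimizer with weight
    \<open>a\<close>.\<close>
  have "A * (f y + ?g \<bullet> (v - y)) \<le> A * f v" "a * (f y + ?g \<bullet> (xmin - y)) \<le> a * f xmin"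
    using above_gradient[of y] assms by (intro mult_left_mono; simp)+
  then have "(A + a) * (f y - f xmin) \<le> A * (f v - f xmin) + A * (?g \<bullet> (y - v)) + a * (?g \<bullet> (y - xmin))"
    by (simp add: inner_diff_right algebra_simps)
  moreover have "A * (?g \<bullet> (y - v)) + a * (?g \<bullet> (y - xmin)) = (A + a) * (?g \<bullet> (y - xt)) + a * (?g \<bullet> (x - xmin))"
    using comb by (simp add: inner_diff_right algebra_simps)
  ultimately have "(A + a) * (f y - f xmin)
      \<le> A * (f v - f xmin) + (A + a) * (?g \<bullet> (y - xt)) + a * (?g \<bullet> (x - xmin))"
    by linarith
  moreover have "(norm (x - a *\<^sub>R ?g - xmin))\<^sup>2
      = (norm (x - xmin))\<^sup>2 - 2 * (a * (?g \<bullet> (x - xmin))) + a\<^sup>2 * (norm ?g)\<^sup>2"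
    unfolding power2_norm_eq_inner
    by (simp add: inner_diff_left inner_diff_right inner_commute power2_eq_square algebra_simps)
  moreover have "2 * ((A + a) * (?g \<bullet> (y - xt))) + a\<^sup>2 * (norm ?g)\<^sup>2 = a\<^sup>2 * (4 * H * (?g \<bullet> (y - xt)) + (norm ?g)\<^sup>2)"
    unfolding a[symmetric] by (simp add: algebra_simps)
  moreover have "\<dots> \<le> 0"
    using descent by (intro mult_nonneg_nonpos) auto
  ultimately show ?thesis
    by linarith
qed


text \<open>The growth of \<open>A\<close> is part of the invariant, so a single union bound gives
  both the potential bound and the rate; the operation counter is left free.\<close>

definition potential_states :: "real \<Rightarrow> real ^ 'n \<Rightarrow> nat \<Rightarrow> (real \<times> (real ^ 'n) \<times> (real ^ 'n) \<times> nat) set" where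
  "potential_states H x0 k = {(A, x, v, t). (real k)\<^sup>2 / (8 * H) \<le> A \<and>
     A * (f v - f xmin) + (norm (x - xmin))\<^sup>2 / 2 \<le> (norm (x0 - xmin))\<^sup>2 / 2}"

lemma meta_step_potential:
  assumes H: "H > 0" and q: "q > 0"
    and Nin: "total_const H Li / H * ln ((1 + L / H) * (3 + 2 * L / H)\<^sup>2 / q) \<le> real Nin"
    and s: "s \<in> potential_states H x0 k"
  shows "measure_pmf.prob (meta_step f H Li cc gc Nin s) (potential_states H x0 (Suc k)) \<ge> 1 - q"
proof -
  obtain A x v t where s_eq: "s = (A, x, v, t)"
    by (cases s)
  have A: "(real k)\<^sup>2 / (8 * H) \<le> A"
    and pot: "A * (f v - f xmin) + (norm (x - xmin))\<^sup>2 / 2 \<le> (norm (x0 - xmin))\<^sup>2 / 2"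
    using s by (auto simp: s_eq potential_states_def)
  define lam where "lam = 1 / (2 * H)"
  define a where "a = (lam + sqrt (lam\<^sup>2 + 4 * lam * A)) / 2"
  define xt where "xt = (A *\<^sub>R v + a *\<^sub>R x) /\<^sub>R (A + a)"
  let ?F = "prox_objective f H xt"
  let ?c = "(1 + L / H) * (3 + 2 * L / H)\<^sup>2"
  have lam: "lam > 0"
    using H by (simp add: lam_def)
  have "0 \<le> (real k)\<^sup>2 / (8 * H)"
    using H by simp
  then have A_nonneg: "A \<ge> 0"
    using A by linarith
  have root: "(sqrt (lam\<^sup>2 + 4 * lam * A))\<^sup>2 = lam\<^sup>2 + 4 * lam * A"
    using lam A_nonneg by simp
  have a_pos: "a > 0"
    using lam A_nonneg by (auto simp: a_def intro!: add_pos_nonneg)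
  \<comment> \<open>The formula for \<open>a\<close> is the positive root of this quadratic
    equation.\<close>
  have "a\<^sup>2 = lam * (A + a)"
    using root unfolding a_def by (simp add: power2_eq_square field_simps)
  then have a_sq: "2 * H * a\<^sup>2 = A + a"
    using H by (simp add: lam_def)
  \<comment> \<open>\<open>A + a \<ge> (sqrt A + sqrt lam / 2)\<^sup>2\<close>, so \<open>sqrt A\<close> grows by \<open>sqrt lam / 2\<close> per step\<close>
  have growth: "(real (Suc k))\<^sup>2 / (8 * H) \<le> A + a"
  proof -
    have "(2 * sqrt (lam * A))\<^sup>2 \<le> lam\<^sup>2 + 4 * lam * A"
      using lam A_nonneg by (simp add: power_mult_distrib)
    then have "2 * sqrt (lam * A) \<le> sqrt (lam\<^sup>2 + 4 * lam * A)"
      by (rule real_le_rsqrt)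
    moreover have "lam * real k / 2 \<le> sqrt (lam * A)"
    proof (rule real_le_rsqrt)
      have "(lam * real k / 2)\<^sup>2 = lam * ((real k)\<^sup>2 / (8 * H))"
        by (simp add: lam_def power2_eq_square)
      also have "\<dots> \<le> lam * A"
        using A lam by (intro mult_left_mono) auto
      finally show "(lam * real k / 2)\<^sup>2 \<le> lam * A" .
    qed
    ultimately have "lam / 2 + lam * real k / 2 \<le> a"
      unfolding a_def by simp
    moreover have "(real (Suc k))\<^sup>2 / (8 * H) = (real k)\<^sup>2 / (8 * H) + (lam * real k / 2 + lam / 4)"
      using H by (simp add: lam_def power2_eq_square field_simps)
    ultimately show ?thesis
      using A lam by linarith
  qed
  have c: "?c > 0"
    using H L_nonneg by (intro mult_pos_pos zero_less_power add_pos_nonneg) auto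
  obtain ys where ys: "\<And>y. ?F ys \<le> ?F y"
    using prox_objective_minimizer[OF H, of xt] by blast
  interpret strongly_convex_coordinate_smooth ?F H Li ys
    by (rule strongly_convex_prox_objective[OF H ys])
  let ?good = "{(v', t' :: nat). ?F v' - ?F ys \<le> (?F xt - ?F ys) / ?c}"
  have "measure_pmf.prob (coord_descent ?F H Li (\<lambda>i y. cc i y + 3) Nin xt) ?good \<ge> 1 - q"
    using q c Nin by (rule coord_descent_gap)
  \<comment> \<open>Once the inner run has succeeded, the rest of the step is deterministic and adds
    no failure probability.\<close>
  moreover have "measure_pmf.prob
      (case s' of (v', t') \<Rightarrow> return_pmf (A + a, x - a *\<^sub>R grad f v', v',
         t + (10 + 4 * CARD('n)) + t' + (gc v' + 2 * CARD('n))))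
      (potential_states H x0 (Suc k)) \<ge> 1 - 0" if "s' \<in> ?good" for s'
  proof -
    obtain v' t' where s': "s' = (v', t')"
      by (cases s')
    have "norm (grad f v' + H *\<^sub>R (v' - xt)) \<le> H / 2 * norm (v' - xt)"
      using that by (intro inexact_prox_condition[OF H ys]) (simp add: s')
    then have "(A + a) * (f v' - f xmin) + (norm (x - a *\<^sub>R grad f v' - xmin))\<^sup>2 / 2
        \<le> A * (f v - f xmin) + (norm (x - xmin))\<^sup>2 / 2"
      using H A_nonneg a_pos a_sq xt_def by (intro potential_step) auto
    then show ?thesis
      using pot growth by (simp add: s' potential_states_def)
  qed
  ultimately have "measure_pmf.prob (coord_descent ?F H Li (\<lambda>i y. cc i y + 3) Nin xt \<bind>
      (\<lambda>s'. case s' of (v', t') \<Rightarrow> return_pmf (A + a, x - a *\<^sub>R grad f v', v',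
         t + (10 + 4 * CARD('n)) + t' + (gc v' + 2 * CARD('n)))))
      (potential_states H x0 (Suc k)) \<ge> 1 - (q + 0)"
    using q by (intro prob_bind_pmf_ge[where A = ?good]) auto
  then show ?thesis
    by (simp add: s_eq meta_step_def Let_def flip: lam_def a_def xt_def)
qed

lemma meta_loop_potential:
  assumes "H > 0" "q > 0"
    and "total_const H Li / H * ln ((1 + L / H) * (3 + 2 * L / H)\<^sup>2 / q) \<le> real Nin"
  shows "measure_pmf.prob (meta_loop f H Li cc gc Nin k x0) (potential_states H x0 k) \<ge> 1 - real k * q"
proof (induction k)
  case 0
  then show ?case
    by (simp add: potential_states_def)
next
  case (Suc k)
  have "measure_pmf.prob (meta_loop f H Li cc gc Nin (Suc k) x0) (potential_states H x0 (Suc k))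
      \<ge> 1 - (real k * q + q)"
    unfolding meta_loop.simps
    using Suc assms meta_step_potential by (intro prob_bind_pmf_ge) auto
  then show ?case
    by (simp add: algebra_simps)
qed

lemma meta_run_accuracy:
  assumes H: "H > 0" and "0 < \<epsilon>" "0 < \<delta>"
  shows "measure_pmf.prob (meta_run f H L Li cc gc x0 xmin \<epsilon> \<delta>) {(v, t). f v - f xmin < \<epsilon>} \<ge> 1 - \<delta>"
proof -
  define R where "R = norm (x0 - xmin)"
  define N where "N = outer_count H x0 xmin \<epsilon>"
  define Nin where "Nin = inner_count H L Li N \<delta>"
  let ?M = "meta_loop f H Li cc gc Nin N x0"
  let ?B = "{(A, x, v, t). f v - f xmin < \<epsilon>}"
  have run: "meta_run f H L Li cc gc x0 xmin \<epsilon> \<delta> = map_pmf (\<lambda>(A, x, v, t). (v, t)) ?M"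
    by (simp add: meta_run_def meta_algorithm_def N_def Nin_def Let_def)
  have "measure_pmf.prob ?M ?B \<ge> 1 - \<delta>"
  \<comment> \<open>If the start is already the minimizer, the outer count is 0 and
    \<open>x0\<close> itself is returned.\<close>
  proof (cases "x0 = xmin")
    case True
    then show ?thesis
      using assms by (simp add: N_def outer_count_def)
  next
    case False
    then have R: "R > 0"
      by (simp add: R_def)
    let ?S = "4 * sqrt 15 / 5 * sqrt (H * R\<^sup>2 / \<epsilon>)"
    have S: "?S > 0"
      using assms R by simp
    have N_ge: "real N \<ge> ?S"
      unfolding N_def outer_count_def R_def[symmetric] by linarith
    then have N_pos: "real N > 0"
      using S by linarith
    have "?S\<^sup>2 \<le> (real N)\<^sup>2"
      using N_ge S by (intro power_mono) auto
    moreover have "?S\<^sup>2 = 48 / 5 * (H * R\<^sup>2 / \<epsilon>)"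
      using assms by (simp add: power_mult_distrib power_divide)
    ultimately have N_sq: "48 / 5 * (H * R\<^sup>2 / \<epsilon>) \<le> (real N)\<^sup>2"
      by simp
    let ?q = "\<delta> / real N"
    have "total_const H Li / H * ln ((1 + L / H) * (3 + 2 * L / H)\<^sup>2 / ?q) \<le> real Nin"
    proof -
      have eq: "(1 + L / H) * (3 + 2 * L / H)\<^sup>2 / ?q = real N / \<delta> * (1 + L / H) * (3 + 2 * L / H)\<^sup>2"
        by simp
      show ?thesis
        unfolding Nin_def inner_count_def eq by linarith
    qed
    then have "measure_pmf.prob ?M (potential_states H x0 N) \<ge> 1 - real N * ?q"
      using assms N_pos by (intro meta_loop_potential) auto
    moreover have "f v - f xmin < \<epsilon>"
      if A: "(real N)\<^sup>2 / (8 * H) \<le> A"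
        and pot: "A * (f v - f xmin) + (norm (x - xmin))\<^sup>2 / 2 \<le> (norm (x0 - xmin))\<^sup>2 / 2" for A x v
    proof -
      \<comment> \<open>The squared outer constant is 48/5, and division by the 8 in the growth
        bound for \<open>A\<close> gives 6/5. This exceeds the 1/2 in the potential, whence the
        strict inequality.\<close>
      have "6 / 5 * R\<^sup>2 = 48 / 5 * (H * R\<^sup>2 / \<epsilon>) / (8 * H) * \<epsilon>"
        using assms by simp
      also have "\<dots> \<le> (real N)\<^sup>2 / (8 * H) * \<epsilon>"
        using N_sq assms by (intro mult_right_mono divide_right_mono) auto
      also have "\<dots> \<le> A * \<epsilon>"
        using A assms by (intro mult_right_mono) auto
      finally have A_ge: "6 / 5 * R\<^sup>2 \<le> A * \<epsilon>" .
      have "0 \<le> (norm (x - xmin))\<^sup>2"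
        by simp
      then have "A * (f v - f xmin) \<le> R\<^sup>2 / 2"
        using pot unfolding R_def by linarith
      also have "\<dots> < A * \<epsilon>"
        using A_ge R zero_less_power[of R 2] by linarith
      finally have less: "A * (f v - f xmin) < A * \<epsilon>" .
      have "0 \<le> (real N)\<^sup>2 / (8 * H)"
        using H by simp
      then have "A \<ge> 0"
        using A by linarith
      then show ?thesis
        using less by (auto simp: mult_less_cancel_left)
    qed
    then have "potential_states H x0 N \<subseteq> ?B"
      unfolding potential_states_def by blast
    then have "measure_pmf.prob ?M (potential_states H x0 N) \<le> measure_pmf.prob ?M ?B"
      by (intro measure_pmf.finite_measure_mono) auto
    ultimately show ?thesis
      using N_pos by simp
  qed
  then show ?thesis
    unfolding run by (simp add: vimage_def case_prod_unfold)
qed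

end

subsection \<open>Operation counts\<close>

text \<open>The 10 n collects 4 n for \<open>xt\<close>, 4 n for setting up the inner method and 2 n
  for updating \<open>x\<close>; the 8 per inner step is 3 for the regulariser and 5 for the
  coordinate update.\<close>

lemma meta_loop_cost:
  fixes f :: "real ^ 'n \<Rightarrow> real"
  assumes cc: "\<And>i x. real (cc i x) \<le> C" and gc: "\<And>x. real (gc x) \<le> G"
    and "(A, x, v, t) \<in> set_pmf (meta_loop f H Li cc gc Nin k x0)"
  shows "real t \<le> real k * (10 + 10 * real CARD('n) + real Nin * (C + 8) + G)"
  using assms(3)
proof (induction k arbitrary: A x v t)
  case (Suc k)
  from Suc.prems obtain A' x' v' t' where
    prev: "(A', x', v', t') \<in> set_pmf (meta_loop f H Li cc gc Nin k x0)"
    and "(A, x, v, t) \<in> set_pmf (meta_step f H Li cc gc Nin (A', x', v', t'))"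
    by auto
  then obtain F xt t'' where
    inner: "(v, t'') \<in> set_pmf (coord_descent F H Li (\<lambda>i y. cc i y + 3) Nin xt)"
    and t: "t = t' + (10 + 4 * CARD('n)) + t'' + (gc v + 2 * CARD('n))"
    by (auto simp: meta_step_def Let_def)
  have "real t'' \<le> real (4 * CARD('n)) + real Nin * (C + 3 + 5)"
    using cd_loop_cost[of "\<lambda>i y. cc i y + 3" "C + 3", OF _ inner[unfolded coord_descent_def]] cc
    by simp
  then show ?case
    using Suc.IH[OF prev] gc[of v] by (simp add: t algebra_simps)
qed auto

section \<open>Sizes of the iteration counts when \<open>H\<close> is the mean coordinate
  constant\<close>

lemma total_const_mean:
  "total_const (mean_const Li) (Li :: 'n::finite \<Rightarrow> real) = 2 * real CARD('n) * mean_const Li"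
  by (simp add: total_const_def mean_const_def sum.distrib)

lemma outer_count_le:
  assumes "sqrt (H * (norm (x0 - xmin))\<^sup>2 / \<epsilon>) \<ge> 2"
  shows "real (outer_count H x0 xmin \<epsilon>) \<le> 4 * sqrt (H * (norm (x0 - xmin))\<^sup>2 / \<epsilon>)"
proof -
  let ?S = "sqrt (H * (norm (x0 - xmin))\<^sup>2 / \<epsilon>)"
  have S: "0 \<le> ?S"
    using assms by linarith
  \<comment> \<open>This makes the leading constant at most 28/9, leaving 8/9 of \<open>?S\<close>
    to absorb the rounding up, as \<open>?S\<close> is at least 2.\<close>
  have "sqrt 15 \<le> (35 / 9 :: real)"
    by (rule real_le_lsqrt) (auto simp: power2_eq_square)
  then have "4 * sqrt 15 / 5 * ?S \<le> 28 / 9 * ?S"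
    using S by (intro mult_right_mono) auto
  moreover have "0 \<le> 4 * sqrt 15 / 5 * ?S"
    using S by (intro mult_nonneg_nonneg[of _ ?S]) auto
  then have "real (outer_count H x0 xmin \<epsilon>) \<le> 4 * sqrt 15 / 5 * ?S + 1"
    unfolding outer_count_def by linarith
  ultimately show ?thesis
    using assms by linarith
qed

text \<open>With Z / H = 2 n and a logarithm of at most \<open>2 * \<Lambda>\<close>, the count
  before rounding is at most \<open>4 * n * \<Lambda>\<close>; rounding adds at most 1, hence the
  5.\<close>

lemma inner_count_le:
  fixes Li :: "'n::finite \<Rightarrow> real"
  assumes H: "mean_const Li = H" "H > 0" and "L \<ge> 0"
    and c: "c = (1 + L / H) * (3 + 2 * L / H)\<^sup>2"
    and N: "1 \<le> N" "real N \<le> B" and \<delta>: "0 < \<delta>" "\<delta> < 1"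
    and \<Lambda>: "ln (B * c / \<delta>) \<le> 2 * \<Lambda>" "1 \<le> \<Lambda>"
  shows "real (inner_count H L Li N \<delta>) \<le> 5 * real CARD('n) * \<Lambda>"
proof -
  let ?n = "real CARD('n)"
  let ?l = "ln (real N / \<delta> * (1 + L / H) * (3 + 2 * L / H)\<^sup>2)"
  have "1 \<le> c"
    unfolding c using assms(2,3)
    by (intro mult_ge1_I one_le_power) (auto intro: add_increasing2)
  have n: "1 \<le> ?n"
    by simp
  have eq: "real N / \<delta> * (1 + L / H) * (3 + 2 * L / H)\<^sup>2 = real N * c / \<delta>"
    by (simp add: c)
  have "1 \<le> real N * c"
    using N \<open>1 \<le> c\<close> by (intro mult_ge1_I) auto
  then have ge1: "1 \<le> real N * c / \<delta>"
    using \<delta> by simp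
  have "real N * c / \<delta> \<le> B * c / \<delta>"
    using N \<open>1 \<le> c\<close> \<delta> by (intro divide_right_mono mult_right_mono) auto
  then have "ln (real N * c / \<delta>) \<le> ln (B * c / \<delta>)"
    using ge1 by (intro ln_mono) auto
  then have "?l \<le> 2 * \<Lambda>"
    using \<Lambda>(1) unfolding eq by (rule order_trans)
  moreover have "0 \<le> ?l"
    using ge1 unfolding eq by (rule ln_ge_zero)
  moreover have "total_const H Li / H = 2 * ?n"
    using total_const_mean[of Li] H by simp
  ultimately have "0 \<le> total_const H Li / H * ?l" "total_const H Li / H * ?l \<le> 2 * ?n * (2 * \<Lambda>)"
    by (auto intro!: mult_left_mono)
  then have "real (inner_count H L Li N \<delta>) \<le> 2 * ?n * (2 * \<Lambda>) + 1"
    unfolding inner_count_def by linarith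
  also have "1 \<le> ?n * \<Lambda>"
    using n \<Lambda>(2) by (rule mult_ge1_I)
  finally show ?thesis
    by (simp add: mult_ac)
qed

text \<open>Arithmetic overhead totals at most 60 units of \<open>s * n * \<Lambda>\<close> and
  derivative evaluations 6 K units. The summand 1 in \<open>1 + K\<close> pays for the
  overhead.\<close>

lemma iteration_cost_le:
  fixes n \<Lambda> s K Nin :: real
  assumes "n \<ge> 1" "\<Lambda> \<ge> 1" "s \<ge> 1" "K \<ge> 0" "0 \<le> Nin" "Nin \<le> 5 * n * \<Lambda>"
  shows "10 + 10 * n + Nin * (K * s + 8) + K * (s * n) \<le> 60 * (1 + K) * (s * n * \<Lambda>)"
proof -
  have n: "n \<le> n * \<Lambda>"
    using assms by simp
  have sn: "n * \<Lambda> \<le> s * n * \<Lambda>"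
    using assms by (simp add: mult_le_cancel_right)
  have "Nin * (K * s + 8) \<le> 5 * n * \<Lambda> * (K * s + 8)"
    using assms by (intro mult_right_mono) auto
  moreover have eqs: "5 * n * \<Lambda> * (K * s + 8) = 5 * (K * (s * n * \<Lambda>)) + 40 * (n * \<Lambda>)"
    "60 * (1 + K) * (s * n * \<Lambda>) = 60 * (s * n * \<Lambda>) + 60 * (K * (s * n * \<Lambda>))"
    by (simp_all add: algebra_simps)
  moreover have "K * (s * n) \<le> K * (s * n * \<Lambda>)"
    using assms by (intro mult_left_mono) auto
  moreover have "0 \<le> K * (s * n * \<Lambda>)"
    using assms by auto
  ultimately show ?thesis
    using n sn assms(1) unfolding eqs by linarith
qed

lemma eventually_complexity_regime:
  assumes "a > 0"
  shows "\<forall>\<^sub>F (\<epsilon>, \<delta>) in at_right 0 \<times>\<^sub>F at_right 0.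
    0 < \<epsilon> \<and> 0 < \<delta> \<and> \<delta> < 1 \<and> 2 \<le> sqrt (a / \<epsilon>) \<and> m \<le> ln (1 / (\<epsilon> powr (1 / 2) * \<delta>))"
proof -
  \<comment> \<open>The first bound makes the square root at least 2; the second makes half of -ln
    \<epsilon> at least \<open>m\<close>, while \<delta> < 1 can only increase the
    logarithm.\<close>
  define e where "e = min (a / 4) (exp (- 2 * m))"
  have "\<forall>\<^sub>F \<epsilon> in at_right 0. 0 < \<epsilon> \<and> \<epsilon> < e"
    using assms by (auto simp: eventually_at_right_field e_def intro!: exI[of _ e])
  moreover have "\<forall>\<^sub>F \<delta> in at_right 0. 0 < \<delta> \<and> \<delta> < (1::real)"
    by (auto simp: eventually_at_right_field intro!: exI[of _ 1])
  moreover have "2 \<le> sqrt (a / \<epsilon>) \<and> m \<le> ln (1 / (\<epsilon> powr (1 / 2) * \<delta>))"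
    if "0 < \<epsilon> \<and> \<epsilon> < e" "0 < \<delta> \<and> \<delta> < 1" for \<epsilon> \<delta>
  proof
    show "2 \<le> sqrt (a / \<epsilon>)"
      using that by (intro real_le_rsqrt) (auto simp: e_def field_simps)
    have "ln \<epsilon> \<le> ln (exp (- 2 * m))"
      using that by (intro ln_mono) (auto simp: e_def)
    moreover have "ln \<delta> \<le> 0"
      using that by simp
    moreover have "ln (1 / (\<epsilon> powr (1 / 2) * \<delta>)) = - (ln \<epsilon> / 2) - ln \<delta>"
      using that by (simp add: ln_div ln_mult ln_powr)
    ultimately show "m \<le> ln (1 / (\<epsilon> powr (1 / 2) * \<delta>))"
      by simp
  qed
  ultimately show ?thesis
    unfolding eventually_prod_filter case_prod_conv by blast
qed


theorem theorem5:
  fixes f :: "real ^ 'n \<Rightarrow> real"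
    and x0 xmin :: "real ^ 'n"
    and L s K :: real
    and Li :: "'n \<Rightarrow> real"
    and cc :: "'n \<Rightarrow> real ^ 'n \<Rightarrow> nat"
    and gc :: "real ^ 'n \<Rightarrow> nat"
  assumes "f differentiable_on UNIV"
    and "convex_on UNIV f"
    and "\<And>x. f xmin \<le> f x"
    and "L-lipschitz_on UNIV (grad f)"
    and "\<And>i x u. \<bar>grad f (x + u *\<^sub>R axis i 1) $ i - grad f x $ i\<bar> \<le> Li i * \<bar>u\<bar>"
    and "mean_const Li > 0"
    and "s \<ge> 1"
    and "\<And>i x. real (cc i x) \<le> K * s"
    and "\<And>x. real (gc x) \<le> K * (s * real CARD('n))"
  shows "(\<forall>\<epsilon> \<delta>. 0 < \<epsilon> \<and> 0 < \<delta> \<and> \<delta> < 1 \<longrightarrow>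
            measure_pmf.prob (meta_run f (mean_const Li) L Li cc gc x0 xmin \<epsilon> \<delta>)
              {(v, t). f v - f xmin < \<epsilon>} \<ge> 1 - \<delta>) \<and>
         (\<forall>\<^sub>F (\<epsilon>, \<delta>) in at_right 0 \<times>\<^sub>F at_right 0.
            \<forall>(v, t) \<in> set_pmf (meta_run f (mean_const Li) L Li cc gc x0 xmin \<epsilon> \<delta>).
              real t \<le> abs_const * (1 + K) *
                (s * real CARD('n) * sqrt (mean_const Li * (norm (x0 - xmin))\<^sup>2 / \<epsilon>) *
                 ln (1 / (\<epsilon> powr (1 / 2) * \<delta>))))"
proof -
  interpret smooth_convex f L Li xmin
    by standard (fact assms)+
  define H where "H = mean_const Li"
  define n where "n = real CARD('n)"
  define R where "R = norm (x0 - xmin)"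
  define c where "c = (1 + L / H) * (3 + 2 * L / H)\<^sup>2"
  have H: "H > 0"
    using assms by (simp add: H_def)
  have n: "n \<ge> 1"
    by (simp add: n_def)
  \<comment> \<open>The sign of \<open>K\<close> follows from costs being natural numbers.\<close>
  have "0 \<le> K * s"
    using assms(8) of_nat_0_le_iff order_trans by blast
  then have K: "K \<ge> 0"
    using assms(7) by (simp add: zero_le_mult_iff)
  have c: "c > 0"
    unfolding c_def using H L_nonneg by (intro mult_pos_pos zero_less_power add_pos_nonneg) auto
  have cost: "real t \<le> real (outer_count H x0 xmin \<epsilon>) *
      (10 + 10 * n + real (inner_count H L Li (outer_count H x0 xmin \<epsilon>) \<delta>) * (K * s + 8) + K * (s * n))"
    if "(v, t) \<in> set_pmf (meta_run f H L Li cc gc x0 xmin \<epsilon> \<delta>)" for v t \<epsilon> \<delta>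
    using that meta_loop_cost[of cc "K * s" gc "K * (s * n)"] assms(8,9)
    unfolding meta_run_def meta_algorithm_def Let_def n_def by auto
  have "\<forall>\<^sub>F (\<epsilon>, \<delta>) in at_right 0 \<times>\<^sub>F at_right 0.
      \<forall>(v, t) \<in> set_pmf (meta_run f H L Li cc gc x0 xmin \<epsilon> \<delta>).
        real t \<le> abs_const * (1 + K) * (s * n * sqrt (H * R\<^sup>2 / \<epsilon>) * ln (1 / (\<epsilon> powr (1 / 2) * \<delta>)))"
  proof (cases "R = 0")
    case True
    then have "outer_count H x0 xmin \<epsilon> = 0" for \<epsilon>
      by (simp add: outer_count_def R_def)
    then show ?thesis
      using cost True by (intro always_eventually) fastforce
  next
    case False
    then have R: "R > 0"
      by (simp add: R_def)
    \<comment> \<open>The logarithm of all problem parameters; once it is below the logarithm in the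
      claim, it costs only a factor 2. The maximum with 1 lets rounding errors be absorbed
      too.\<close>
    define m where "m = max 1 (ln (4 * sqrt (H * R\<^sup>2) * c))"
    have "H * R\<^sup>2 > 0"
      using H R by simp
    from eventually_complexity_regime[OF this, of m] show ?thesis
    proof (rule eventually_mono, clarify)
      fix \<epsilon> \<delta> v t
      let ?S = "sqrt (H * R\<^sup>2 / \<epsilon>)" and ?\<Lambda> = "ln (1 / (\<epsilon> powr (1 / 2) * \<delta>))"
      let ?N = "outer_count H x0 xmin \<epsilon>"
      let ?Nin = "inner_count H L Li ?N \<delta>"
      assume \<epsilon>: "0 < \<epsilon>" and \<delta>: "0 < \<delta>" "\<delta> < 1" and S: "2 \<le> ?S" and \<Lambda>: "m \<le> ?\<Lambda>"
        and vt: "(v, t) \<in> set_pmf (meta_run f H L Li cc gc x0 xmin \<epsilon> \<delta>)"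
      have S0: "0 \<le> H * R\<^sup>2 / \<epsilon>"
        using \<open>H * R\<^sup>2 > 0\<close> \<epsilon> by simp
      have N_le: "real ?N \<le> 4 * ?S"
        using S unfolding R_def by (rule outer_count_le)
      have \<Lambda>1: "1 \<le> ?\<Lambda>"
        using \<Lambda> by (simp add: m_def)
      \<comment> \<open>Separates the dependence on \<epsilon> and \<delta>, which is exactly the
        argument of \<open>?\<Lambda>\<close>, from a constant whose logarithm is at most
        \<open>m\<close>.\<close>
      have "4 * ?S * c / \<delta> = (4 * sqrt (H * R\<^sup>2) * c) * (1 / (\<epsilon> powr (1 / 2) * \<delta>))"
        using \<epsilon> by (simp add: real_sqrt_divide powr_half_sqrt)
      also have "ln \<dots> = ln (4 * sqrt (H * R\<^sup>2) * c) + ?\<Lambda>"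
        using \<open>H * R\<^sup>2 > 0\<close> c \<epsilon> \<delta> by (intro ln_mult_pos) auto
      also have "\<dots> \<le> 2 * ?\<Lambda>"
        using \<Lambda> by (simp add: m_def)
      finally have ln_le: "ln (4 * ?S * c / \<delta>) \<le> 2 * ?\<Lambda>" .
      let ?T = "10 + 10 * n + real ?Nin * (K * s + 8) + K * (s * n)"
      have "real t \<le> real ?N * ?T"
        by (rule cost[OF vt])
      also have "\<dots> \<le> 4 * ?S * (60 * (1 + K) * (s * n * ?\<Lambda>))"
      \<comment> \<open>The bound on the inner count requires a positive outer count, so that the
        argument of its logarithm is at least 1.\<close>
      proof (cases "?N = 0")
        case True
        moreover have "0 \<le> 4 * ?S * (60 * (1 + K) * (s * n * ?\<Lambda>))"
          using S0 \<Lambda>1 n K assms(7) by (intro mult_nonneg_nonneg) auto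
        ultimately show ?thesis
          by (simp only: of_nat_0 mult_zero_left)
      next
        case False
        have "real ?Nin \<le> 5 * n * ?\<Lambda>"
          unfolding n_def using H_def H L_nonneg c_def False N_le \<delta> ln_le \<Lambda>1
          by (intro inner_count_le[where B = "4 * ?S" and c = c]) auto
        then have "?T \<le> 60 * (1 + K) * (s * n * ?\<Lambda>)"
          using n \<Lambda>1 assms(7) K by (intro iteration_cost_le) auto
        then show ?thesis
          using N_le n K S0 assms(7) by (intro mult_mono) auto
      qed
      also have "\<dots> = 240 * ((1 + K) * (s * n * ?S * ?\<Lambda>))"
        by (simp add: mult_ac)
      also have "\<dots> \<le> abs_const * ((1 + K) * (s * n * ?S * ?\<Lambda>))"
        using S0 \<Lambda>1 n K assms(7) unfolding abs_const_def
        by (intro mult_right_mono mult_nonneg_nonneg) auto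
      finally show "real t \<le> abs_const * (1 + K) * (s * n * ?S * ?\<Lambda>)"
        by (simp only: mult.assoc)
    qed
  qed
  then show ?thesis
    using meta_run_accuracy[OF H] unfolding H_def n_def R_def by blast
qed

end
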